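(* Let $T$ be a tree on $n+1$ vertices, rooted at its sink $s$ and with non-sink vertices labeled $v_1,\dots,v_n$. If $\mathscr{A}_T(x_1,\dots,x_n)=\mathscr{A}_{T'}(x_1,\dots,x_n)$ for some tree $T'$ rooted at its sink $s$ and with non-sink vertices labeled $v_1,\dots,v_n$, then $T=T'$ as labeled rooted trees (that is, $T$ and $T'$ have the same edge set on the vertex set $\{s,v_1,\dots,v_n\}$).
   Context: A graph $G=(V,E,s)$ is a finite connected undirected multigraph without loops, with a distinguished vertex $s$ called the sink; $\widetilde V = V\setminus\{s\}$. $d_v$ is the degree of $v$ (counted with multiplicity, including edges to $s$) and $\mathrm{wt}(u,v)$ is the number of edges between $u$ and $v$. A sandpile is a function $c:\widetilde V\to\mathbb{Z}_{\ge 0}$. A vertex $v\in\widetilde V$ is unstable if $c(v)\ge d_v$; an unstable vertex may topple, which replaces $c$ by $c'$ with $c'(v)=c(v)-d_v$ and $c'(w)=c(w)+\mathrm{wt}(v,w)$ for $w\in\widetilde V$, $w\ne v$. A sandpile is stable if it has no unstable vertex. Any sequence of topplings of unstable vertices starting at $c$ that ends in a stable sandpile ends in the same stable sandpile $c^\circ$ (the stabilization), with the same number of topplings of each vertex; the vector of these numbers is the toppling vector of the stabilization. Put $a\oplus b=(a+b)^\circ$. A stable sandpile $c$ is recurrent if for every sandpile $a$ there is a sandpile $b$ with $a\oplus b=c$; the set of recurrent sandpiles is $\mathscr{S}(G)$. For $v\in\widetilde V$, $1_v$ is the sandpile with one grain at $v$ and none elsewhere. For $\widetilde V=\{v_1,\dots,v_n\}$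 with associated variables $x_1,\dots,x_n$, and $c$ recurrent, the avalanche monomial is $\mu_G(c,v_k)=\prod_{i=1}^n x_i^{f_i}$, where $(f_1,\dots,f_n)$ is the toppling vector of the stabilization of $c+1_{v_k}$. The multivariate avalanche polynomial is $\mathscr{A}_G(x_1,\dots,x_n)=\sum_{c\in\mathscr{S}(G)}\sum_{v\in\widetilde V}\mu_G(c,v)$ (it is $0$ if $G$ has only the vertex $s$). *)

theory Defs
  imports "HOL-Library.Multiset" "HOL-Library.Poly_Mapping"
begin

text \<open>Edges are unordered pairs of distinct vertices, collected in a multiset.\<close>

record 'v sgraph =
  verts :: "'v set"
  edges :: "'v set multiset"
  sink :: 'v

definition wt :: "'v sgraph \<Rightarrow> 'v \<Rightarrow> 'v \<Rightarrow> nat" where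
  "wt G u w = count (edges G) {u, w}"

definition deg :: "'v sgraph \<Rightarrow> 'v \<Rightarrow> nat" where
  "deg G v = size (filter_mset (\<lambda>e. v \<in> e) (edges G))"

definition nonsink :: "'v sgraph \<Rightarrow> 'v set" where
  "nonsink G = verts G - {sink G}"

definition connected_graph :: "'v sgraph \<Rightarrow> bool" where
  "connected_graph G \<longleftrightarrow>
     (\<forall>u\<in>verts G. \<forall>w\<in>verts G. (u, w) \<in> {(a, b). {a, b} \<in># edges G}\<^sup>*)"

definition sandpile_graph :: "'v sgraph \<Rightarrow> bool" where
  "sandpile_graph G \<longleftrightarrow>
     finite (verts G) \<and> sink G \<in> verts G \<and>
     (\<forall>e. e \<in># edges G \<longrightarrow> e \<subseteq> verts G \<and> card e = 2) \<and>
     connected_graph G"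

text \<open>A cycle is given by its list of vertices. Comparing multisets of edges makes two parallel
  edges a cycle of length 2, whereas a single edge traversed back and forth is not a cycle.\<close>

definition is_cycle :: "'v sgraph \<Rightarrow> 'v list \<Rightarrow> bool" where
  "is_cycle G p \<longleftrightarrow>
     length p \<ge> 2 \<and> distinct p \<and>
     mset (map (\<lambda>i. {p ! i, p ! (Suc i mod length p)}) [0..<length p]) \<subseteq># edges G"

definition tree :: "'v sgraph \<Rightarrow> bool" where
  "tree G \<longleftrightarrow> sandpile_graph G \<and> \<not> (\<exists>p. is_cycle G p)"

text \<open>Sandpiles live on the non-sink vertices; they are extended by 0 to the whole type so that
  distinct functions are distinct sandpiles.\<close>

definition sandpile :: "'v sgraph \<Rightarrow> ('v \<Rightarrow> nat) \<Rightarrow> bool" where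
  "sandpile G c \<longleftrightarrow> (\<forall>v. v \<notin> nonsink G \<longrightarrow> c v = 0)"

definition unstable :: "'v sgraph \<Rightarrow> ('v \<Rightarrow> nat) \<Rightarrow> 'v \<Rightarrow> bool" where
  "unstable G c v \<longleftrightarrow> v \<in> nonsink G \<and> c v \<ge> deg G v"

definition stable :: "'v sgraph \<Rightarrow> ('v \<Rightarrow> nat) \<Rightarrow> bool" where
  "stable G c \<longleftrightarrow> \<not> (\<exists>v. unstable G c v)"

definition topple :: "'v sgraph \<Rightarrow> 'v \<Rightarrow> ('v \<Rightarrow> nat) \<Rightarrow> 'v \<Rightarrow> nat" where
  "topple G v c =
     (\<lambda>w. if w = v then c v - deg G v
          else if w \<in> nonsink G then c w + wt G v w
          else c w)"

text \<open>\<open>legal_topplings G c vs c'\<close>: toppling the vertices of \<open>vs\<close> in this order, each unstable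
  when it is its turn, leads from \<open>c\<close> to \<open>c'\<close>.\<close>

inductive legal_topplings ::
  "'v sgraph \<Rightarrow> ('v \<Rightarrow> nat) \<Rightarrow> 'v list \<Rightarrow> ('v \<Rightarrow> nat) \<Rightarrow> bool" for G where
  Nil: "legal_topplings G c [] c"
| Cons: "unstable G c v \<Longrightarrow> legal_topplings G (topple G v c) vs c' \<Longrightarrow>
    legal_topplings G c (v # vs) c'"

definition stabilization :: "'v sgraph \<Rightarrow> ('v \<Rightarrow> nat) \<Rightarrow> 'v \<Rightarrow> nat" where
  "stabilization G c = (THE c'. \<exists>vs. legal_topplings G c vs c' \<and> stable G c')"

definition toppling_vector :: "'v sgraph \<Rightarrow> ('v \<Rightarrow> nat) \<Rightarrow> 'v \<Rightarrow> nat" where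
  "toppling_vector G c =
     (THE f. \<exists>vs c'. legal_topplings G c vs c' \<and> stable G c' \<and> f = count_list vs)"

definition stable_add :: "'v sgraph \<Rightarrow> ('v \<Rightarrow> nat) \<Rightarrow> ('v \<Rightarrow> nat) \<Rightarrow> 'v \<Rightarrow> nat" where
  "stable_add G a b = stabilization G (\<lambda>v. a v + b v)"

definition recurrents :: "'v sgraph \<Rightarrow> ('v \<Rightarrow> nat) set" where
  "recurrents G =
     {c. sandpile G c \<and> stable G c \<and>
         (\<forall>a. sandpile G a \<longrightarrow> (\<exists>b. sandpile G b \<and> stable_add G a b = c))}"

definition grain :: "'v \<Rightarrow> 'v \<Rightarrow> nat" where
  "grain v = (\<lambda>w. if w = v then 1 else 0)"

text \<open>Integer polynomials in variables indexed by \<^typ>\<open>nat\<close>: finitely supported maps from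
  exponent vectors to coefficients, multiplied by convolution.\<close>

type_synonym mvpoly = "(nat \<Rightarrow>\<^sub>0 nat) \<Rightarrow>\<^sub>0 int"

definition var :: "nat \<Rightarrow> mvpoly" where
  "var i = Poly_Mapping.single (Poly_Mapping.single i 1) 1"

text \<open>The function \<open>lab\<close> labels the non-sink vertices by \<open>1, \<dots>, n\<close>.\<close>

definition avalanche_monomial ::
  "nat \<Rightarrow> (nat \<Rightarrow> 'v) \<Rightarrow> 'v sgraph \<Rightarrow> ('v \<Rightarrow> nat) \<Rightarrow> 'v \<Rightarrow> mvpoly" where
  "avalanche_monomial n lab G c u =
     (\<Prod>i=1..n. var i ^ toppling_vector G (\<lambda>w. c w + grain u w) (lab i))"

definition avalanche_poly :: "nat \<Rightarrow> (nat \<Rightarrow> 'v) \<Rightarrow> 'v sgraph \<Rightarrow> mvpoly" where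
  "avalanche_poly n lab G =
     (\<Sum>c\<in>recurrents G. \<Sum>u\<in>nonsink G. avalanche_monomial n lab G c u)"

end

theory Submission imports Defs begin

text \<open>Let \<open>m\<close> be the maximal stable sandpile of a tree. Toppling every vertex of the subtree below
  \<open>u\<close> once, parents first, moves the extra grain of \<open>m + 1\<^sub>u\<close> to the parent of \<open>u\<close>, and
  iterating this carries the grain into the sink. Hence \<open>m\<close> is the only recurrent sandpile, and in
  the stabilization of \<open>m + 1\<^sub>u\<close> the vertex \<open>w\<close> topples as often as \<open>u\<close> and \<open>w\<close>
  have common non-sink ancestors (each vertex being an ancestor of itself). So the polynomial determines the
  set of rows of the matrix of these numbers. The maximum of column \<open>w\<close> is the number of
  ancestors of \<open>w\<close>, and it is attained exactly in the rows of the descendants of \<open>w\<close>. Thus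
  \<open>w\<close> is an ancestor of \<open>u\<close> iff every row that is maximal in column \<open>u\<close> is maximal in
  column \<open>w\<close>, and the ancestor relation determines the tree.\<close>

section \<open>Uniqueness of stabilization\<close>

lemma distinct_count_list: "distinct xs \<Longrightarrow> count_list xs x = (if x \<in> set xs then 1 else 0)"
  by (induction xs) auto

lemma sandpile_graph_wt_self:
  assumes "sandpile_graph G"
  shows "wt G w w = 0"
proof -
  have "{w} \<notin># edges G"
    using assms by (auto simp: sandpile_graph_def dest!: spec[of _ "{w}"])
  then show ?thesis
    by (simp add: wt_def count_eq_zero_iff)
qed

lemma finite_nonsink: "sandpile_graph G \<Longrightarrow> finite (nonsink G)"
  by (simp add: sandpile_graph_def nonsink_def)

lemma legal_topplings_append:
  "legal_topplings G c vs c' \<Longrightarrow> legal_topplings G c' ws c'' \<Longrightarrow> legal_topplings G c (vs @ ws) c''"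
  by (induction rule: legal_topplings.induct) (auto intro: legal_topplings.intros)

lemma legal_topplings_snoc:
  "legal_topplings G c vs c' \<Longrightarrow> unstable G c' v \<Longrightarrow> legal_topplings G c (vs @ [v]) (topple G v c')"
  by (rule legal_topplings_append) (auto intro: legal_topplings.intros)

lemma legal_topplings_appendE:
  assumes "legal_topplings G c (vs @ ws) c''"
  obtains c' where "legal_topplings G c vs c'" "legal_topplings G c' ws c''"
proof -
  have "\<exists>c'. legal_topplings G c vs c' \<and> legal_topplings G c' ws c''"
    using assms
  proof (induction vs arbitrary: c)
    case Nil
    then show ?case by (auto intro: legal_topplings.intros)
  next
    case (Cons v vs)
    from Cons.prems have "unstable G c v" "legal_topplings G (topple G v c) (vs @ ws) c''"
      by (auto elim: legal_topplings.cases)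
    with Cons.IH show ?case by (blast intro: legal_topplings.Cons)
  qed
  with that show thesis by blast
qed

lemma legal_topplings_set:
  "legal_topplings G c vs c' \<Longrightarrow> set vs \<subseteq> nonsink G"
  by (induction rule: legal_topplings.induct) (auto simp: unstable_def)

lemma legal_topplings_sink:
  "legal_topplings G c vs c' \<Longrightarrow> w \<notin> nonsink G \<Longrightarrow> c' w = c w"
  by (induction rule: legal_topplings.induct) (auto simp: unstable_def topple_def)

lemma legal_topplings_add:
  "legal_topplings G c vs c' \<Longrightarrow> legal_topplings G (\<lambda>w. c w + b w) vs (\<lambda>w. c' w + b w)"
proof (induction rule: legal_topplings.induct)
  case (Nil c)
  then show ?case by (rule legal_topplings.Nil)
next
  case (Cons c v vs c')
  \<comment> \<open>Subtraction on naturals is truncated; adding \<open>b v\<close> commutes with it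
    because the instability of \<open>v\<close> gives \<open>deg G v\<close> \<le>
    \<open>c v\<close>.\<close>
  have "topple G v (\<lambda>w. c w + b w) = (\<lambda>w. topple G v c w + b w)"
    using Cons.hyps(1) by (auto simp: topple_def unstable_def)
  with Cons show ?case
    by (auto intro!: legal_topplings.Cons simp: unstable_def)
qed

text \<open>The Laplacian identity, with the subtracted term moved to the left-hand side.\<close>

lemma legal_topplings_balance:
  assumes "sandpile_graph G" and "legal_topplings G c vs c'" and "w \<in> nonsink G"
  shows "c' w + count_list vs w * deg G w = c w + (\<Sum>x\<in>nonsink G. count_list vs x * wt G x w)"
  using assms(2)
proof (induction rule: legal_topplings.induct)
  case (Nil c)
  then show ?case by simp
next
  case (Cons c v vs c')
  note fin = finite_nonsink[OF assms(1)]
  have v: "v \<in> nonsink G" "deg G v \<le> c v"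
    using Cons.hyps(1) by (auto simp: unstable_def)
  have "(\<Sum>x\<in>nonsink G. count_list (v # vs) x * wt G x w)
      = (\<Sum>x\<in>nonsink G. (if x = v then wt G x w else 0) + count_list vs x * wt G x w)"
    by (rule sum.cong) auto
  also have "\<dots> = wt G v w + (\<Sum>x\<in>nonsink G. count_list vs x * wt G x w)"
    using fin v(1) by (simp add: sum.distrib)
  \<comment> \<open>For \<open>w = v\<close> the sum also counts \<open>wt G v v\<close>, which
    \<open>topple\<close> never adds; it vanishes since there are no loops.\<close>
  finally show ?case
    using Cons.IH v assms(3) sandpile_graph_wt_self[OF assms(1), of w]
    by (auto simp: topple_def)
qed

text \<open>Least action principle: consider the first toppling of some \<open>v\<close> that would
  exceed its count in \<open>ws\<close>. Up to then the neighbours of \<open>v\<close> have sent at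
  most as many grains as under \<open>ws\<close>, so \<open>v\<close> holds at most
  \<open>d v\<close> grains and cannot be unstable.\<close>

lemma legal_topplings_least_action:
  assumes G: "sandpile_graph G"
    and ws: "legal_topplings G c ws d" "stable G d"
    and vs: "legal_topplings G c vs c'"
  shows "count_list vs x \<le> count_list ws x"
  using vs
proof (induction vs arbitrary: c' x rule: rev_induct)
  case Nil
  then show ?case by simp
next
  case (snoc v vs)
  obtain c1 where c1: "legal_topplings G c vs c1" "legal_topplings G c1 [v] c'"
    using snoc.prems by (rule legal_topplings_appendE)
  have v: "v \<in> nonsink G" "deg G v \<le> c1 v"
    using c1(2) by (auto simp: unstable_def elim: legal_topplings.cases)
  have le: "count_list vs y \<le> count_list ws y" for y
    by (rule snoc.IH[OF c1(1)])
  have "count_list vs v \<noteq> count_list ws v"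
  proof
    assume eq: "count_list vs v = count_list ws v"
    have "(\<Sum>y\<in>nonsink G. count_list vs y * wt G y v) \<le> (\<Sum>y\<in>nonsink G. count_list ws y * wt G y v)"
      by (intro sum_mono mult_right_mono le) simp
    with legal_topplings_balance[OF G c1(1) v(1)] legal_topplings_balance[OF G ws(1) v(1)] eq
    have "c1 v \<le> d v" by simp
    with v ws(2) show False
      by (auto simp: stable_def unstable_def)
  qed
  with le[of v] le[of x] show ?case
    by auto
qed

text \<open>Two stabilizing sequences bound each other's counts by least action, and the balance
  equation recovers the final sandpile from the counts.\<close>

lemma legal_topplings_stable_unique:
  assumes G: "sandpile_graph G"
    and "legal_topplings G c vs c'" "stable G c'" "legal_topplings G c ws d" "stable G d"
  shows "d = c'" and "count_list ws = count_list vs"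
proof -
  show eq: "count_list ws = count_list vs"
    by (rule ext, rule antisym) (rule legal_topplings_least_action[OF G]; fact)+
  show "d = c'"
  proof
    fix w
    show "d w = c' w"
    proof (cases "w \<in> nonsink G")
      case True
      show ?thesis
        using legal_topplings_balance[OF G assms(2) True]
          legal_topplings_balance[OF G assms(4) True] eq by simp
    next
      case False
      then show ?thesis
        using legal_topplings_sink assms(2,4) by metis
    qed
  qed
qed

lemma stabilization_eqI:
  assumes "sandpile_graph G" "legal_topplings G c vs c'" "stable G c'"
  shows "stabilization G c = c'"
  unfolding stabilization_def
  using assms legal_topplings_stable_unique(1)[OF assms] by (intro the_equality) blast+

lemma toppling_vector_eqI:
  assumes "sandpile_graph G" "legal_topplings G c vs c'" "stable G c'"
  shows "toppling_vector G c = count_list vs"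
  unfolding toppling_vector_def
  using assms legal_topplings_stable_unique(2)[OF assms] by (intro the_equality) blast+

section \<open>Sandpiles on rooted trees\<close>

text \<open>A tree presented by a parent map. \<open>depth\<close> may be any measure that decreases
  along \<open>par\<close>; it serves inductions and rules out loops. Indexing edges by their lower
  endpoint turns degrees into counts of children.\<close>

locale rooted_sandpile_tree =
  fixes G :: "'v sgraph" and par :: "'v \<Rightarrow> 'v" and depth :: "'v \<Rightarrow> nat"
  assumes graph: "sandpile_graph G"
    and par_verts: "v \<in> nonsink G \<Longrightarrow> par v \<in> verts G"
    and depth_par: "v \<in> nonsink G \<Longrightarrow> depth (par v) < depth v"
    and edges_eq: "edges G = image_mset (\<lambda>v. {v, par v}) (mset_set (nonsink G))"
begin

text \<open>Reflexive but without the sink, so the sink has no ancestors and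
  \<open>card (anc x)\<close> is the distance from \<open>x\<close> to the root. Pairs start at
  non-sink vertices because \<open>par (sink G)\<close> is unconstrained.\<close>

definition anc :: "'v \<Rightarrow> 'v set" where
  "anc x = {w \<in> nonsink G. (x, w) \<in> {(a, par a) |a. a \<in> nonsink G}\<^sup>*}"

definition subtree :: "'v \<Rightarrow> 'v set" where
  "subtree u = {w \<in> nonsink G. u \<in> anc w}"

definition children :: "'v \<Rightarrow> 'v set" where
  "children w = {v \<in> nonsink G. par v = w}"

definition max_stable :: "'v \<Rightarrow> nat" where
  "max_stable w = (if w \<in> nonsink G then deg G w - 1 else 0)"

lemmas finN = finite_nonsink[OF graph]

section \<open>Ancestor sets\<close>

lemma par_cases: "v \<in> nonsink G \<Longrightarrow> par v = sink G \<or> par v \<in> nonsink G"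
  using par_verts by (auto simp: nonsink_def)

lemma sink_notin_nonsink: "sink G \<notin> nonsink G"
  by (simp add: nonsink_def)

lemma anc_sink: "anc (sink G) = {}"
  using sink_notin_nonsink by (auto simp: anc_def elim: converse_rtranclE)

lemma anc_rec:
  assumes "x \<in> nonsink G"
  shows "anc x = insert x (anc (par x))"
  using assms unfolding anc_def
  by (auto elim: converse_rtranclE intro: converse_rtrancl_into_rtrancl)

lemma anc_subset: "anc x \<subseteq> nonsink G"
  by (auto simp: anc_def)

lemma finite_anc: "finite (anc x)"
  using anc_subset finN by (rule finite_subset)

lemma anc_refl: "x \<in> nonsink G \<Longrightarrow> x \<in> anc x"
  by (simp add: anc_def)

lemma anc_trans: "y \<in> anc x \<Longrightarrow> anc y \<subseteq> anc x"
  by (auto simp: anc_def)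

lemma anc_depth:
  assumes "y \<in> anc x"
  shows "y = x \<or> depth y < depth x"
proof -
  have "(x, y) \<in> {(a, par a) |a. a \<in> nonsink G}\<^sup>*"
    using assms by (simp add: anc_def)
  then show ?thesis
    by induction (auto dest: depth_par)
qed

lemma self_notin_anc_par: "x \<in> nonsink G \<Longrightarrow> x \<notin> anc (par x)"
  using anc_depth[of x "par x"] depth_par[of x] by auto

lemma anc_par: "x \<in> nonsink G \<Longrightarrow> anc (par x) = anc x - {x}"
  using anc_rec[of x] self_notin_anc_par[of x] by auto

text \<open>Vertices that are ancestors of each other coincide, by depth, and only the sink has an
  empty ancestor set.\<close>

lemma anc_inj: "inj_on anc (verts G)"
proof (rule inj_onI)
  fix x y assume xy: "x \<in> verts G" "y \<in> verts G" "anc x = anc y"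
  show "x = y"
  proof (cases "x \<in> nonsink G \<and> y \<in> nonsink G")
    case True
    then have "x \<in> anc y" "y \<in> anc x"
      using anc_refl xy(3) by auto
    then show ?thesis
      using anc_depth[of x y] anc_depth[of y x] by auto
  next
    case False
    then show ?thesis
      using xy anc_sink anc_refl[of x] anc_refl[of y] by (auto simp: nonsink_def)
  qed
qed

section \<open>Degrees and edge weights from the parent map\<close>

lemma finite_children: "finite (children w)"
  using finN by (simp add: children_def)

lemma deg_eq:
  assumes "w \<in> nonsink G"
  shows "deg G w = Suc (card (children w))"
proof -
  have "deg G w = card {v \<in> nonsink G. w \<in> {v, par v}}"
    unfolding deg_def edges_eq by (simp add: filter_mset_image_mset filter_mset_mset_set finN)
  also have "{v \<in> nonsink G. w \<in> {v, par v}} = insert w (children w)"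
    using assms by (auto simp: children_def)
  also have "card \<dots> = Suc (card (children w))"
    using assms depth_par[of w] finite_children by (subst card_insert_disjoint) (auto simp: children_def)
  finally show ?thesis .
qed

lemma wt_eq:
  assumes "w \<in> nonsink G"
  shows "wt G x w = (if x = par w then 1 else 0) + (if x \<in> children w then 1 else 0)"
proof -
  have "wt G x w = card {v \<in> nonsink G. {v, par v} = {x, w}}"
    unfolding wt_def edges_eq by (simp add: count_image_mset' finN, intro arg_cong[of _ _ card]) auto
  also have "{v \<in> nonsink G. {v, par v} = {x, w}}
      = (if x = par w then {w} else {}) \<union> (if x \<in> children w then {x} else {})"
    using assms by (auto simp: children_def doubleton_eq_iff)
  also have "card \<dots> = (if x = par w then 1 else 0) + (if x \<in> children w then 1 else 0)"
    using assms depth_par[of w] depth_par[of x] by (auto simp: children_def)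
  finally show ?thesis .
qed

lemma sum_wt:
  assumes "w \<in> nonsink G" "finite A"
  shows "(\<Sum>x\<in>A. wt G x w) = (if par w \<in> A then 1 else 0) + card (children w \<inter> A)"
proof -
  have "(\<Sum>x\<in>A. wt G x w) = (\<Sum>x\<in>A. if x = par w then 1 else 0) + (\<Sum>x\<in>A. if x \<in> children w then 1 else 0)"
    by (simp add: wt_eq[OF assms(1)] sum.distrib)
  also have "(\<Sum>x\<in>A. if x \<in> children w then 1 else 0) = card (children w \<inter> A)"
    using assms(2) by (simp add: sum.If_cases Int_commute)
  finally show ?thesis
    using assms(2) by simp
qed

section \<open>The avalanche caused by one grain\<close>

lemma toppling_each_once:
  assumes "legal_topplings G c vs c'" "distinct vs" "w \<in> nonsink G"
  shows "c' w + (if w \<in> set vs then deg G w else 0)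
    = c w + (if par w \<in> set vs then 1 else 0) + card (children w \<inter> set vs)"
proof -
  have cnt: "count_list vs x = (if x \<in> set vs then 1 else 0)" for x
    using assms(2) by (simp add: distinct_count_list)
  \<comment> \<open>Without repetitions the counts are indicators, so the inflow at \<open>w\<close>
    just counts its neighbours in \<open>set vs\<close>.\<close>
  have "(\<Sum>x\<in>nonsink G. count_list vs x * wt G x w) = (\<Sum>x\<in>set vs. wt G x w)"
    using legal_topplings_set[OF assms(1)] finN
    by (intro sum.mono_neutral_cong_right) (auto simp: cnt)
  with legal_topplings_balance[OF graph assms(1,3)] sum_wt[OF assms(3), of "set vs"] show ?thesis
    by (auto simp: cnt split: if_splits)
qed

text \<open>Passing to sets closed under parents up to \<open>u\<close> makes an induction possible:
  a deepest vertex can be removed and toppled last.\<close>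

lemma topple_part_of_subtree:
  assumes "u \<in> nonsink G" "A \<subseteq> subtree u" "\<And>w. w \<in> A \<Longrightarrow> w \<noteq> u \<Longrightarrow> par w \<in> A"
  shows "\<exists>vs c'. legal_topplings G (\<lambda>w. max_stable w + grain u w) vs c' \<and> distinct vs \<and> set vs = A"
proof -
  have "finite A"
    using assms(2) finN by (auto simp: subtree_def intro: finite_subset)
  then show ?thesis
    using assms(2,3)
  proof (induction A rule: finite_psubset_induct)
    case (psubset A)
    show ?case
    proof (cases "A = {}")
      case True
      then show ?thesis by (auto intro: legal_topplings.Nil exI[of _ "[]"])
    next
      case False
      have "Max (depth ` A) \<in> depth ` A"
        using psubset.hyps False by (intro Max_in) auto
      then obtain w where w: "w \<in> A" "depth w = Max (depth ` A)"
        by auto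
      have max: "depth x \<le> depth w" if "x \<in> A" for x
        using that psubset.hyps w(2) by simp
      have sub: "x \<in> nonsink G" if "x \<in> A" for x
        using that psubset.prems(1) by (auto simp: subtree_def)
      \<comment> \<open>A parent is strictly less deep than its child, so the deepest vertex
        \<open>w\<close> is no parent within \<open>A\<close>.\<close>
      have closed: "par x \<in> A - {w}" if "x \<in> A" "x \<noteq> u" for x
        using psubset.prems(2)[OF that] depth_par[OF sub[OF that(1)]] max[OF that(1)] by auto
      obtain vs c' where vs: "legal_topplings G (\<lambda>w. max_stable w + grain u w) vs c'"
          "distinct vs" "set vs = A - {w}"
        using psubset.IH[of "A - {w}"] w(1) psubset.prems(1) closed by auto
      \<comment> \<open>\<open>w\<close> has not toppled and starts one grain short of its degree;
        that grain is the added one if \<open>w = u\<close>, and otherwise comes from the parent,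
        which has toppled.\<close>
      have "deg G w \<le> c' w"
        using toppling_each_once[OF vs(1,2) sub[OF w(1)]] vs(3) closed[OF w(1)]
          deg_eq[OF sub[OF w(1)]] sub[OF w(1)]
        by (cases "w = u") (auto simp: max_stable_def grain_def)
      then have "legal_topplings G (\<lambda>w. max_stable w + grain u w) (vs @ [w]) (topple G w c')"
        using sub[OF w(1)] by (intro legal_topplings_snoc vs(1)) (simp add: unstable_def)
      then show ?thesis
        using vs(2,3) w(1) by (intro exI[of _ "vs @ [w]"]) auto
    qed
  qed
qed

text \<open>Below \<open>u\<close>, every neighbour of a vertex topples once, so losses and gains
  cancel. Only the edge from \<open>u\<close> to its parent joins the subtree to the rest, and it
  carries one grain out. If the parent is the sink, that grain disappears, whence the test for
  \<open>nonsink G\<close>.\<close>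

lemma topple_subtree:
  assumes "u \<in> nonsink G"
  obtains vs where
    "legal_topplings G (\<lambda>w. max_stable w + grain u w) vs
       (\<lambda>w. max_stable w + (if w \<in> nonsink G then grain (par u) w else 0))"
    "distinct vs" "set vs = subtree u"
proof -
  have par_sub: "par w \<in> subtree u" if "w \<in> subtree u" "w \<noteq> u" for w
    using that anc_rec[of w] par_cases[of w] anc_sink by (auto simp: subtree_def)
  obtain vs c' where vs: "legal_topplings G (\<lambda>w. max_stable w + grain u w) vs c'"
      "distinct vs" "set vs = subtree u"
    using topple_part_of_subtree[OF assms subset_refl par_sub] by blast
  have "c' w = max_stable w + (if w \<in> nonsink G then grain (par u) w else 0)" for w
  proof (cases "w \<in> nonsink G")
    case False
    then show ?thesis
      using legal_topplings_sink[OF vs(1) False] assms by (auto simp: grain_def)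
  next
    case w: True
    note eq = toppling_each_once[OF vs(1,2) w, unfolded vs(3)]
    show ?thesis
    proof (cases "w \<in> subtree u")
      case True
      have "children w \<inter> subtree u = children w"
        using True anc_rec by (auto simp: children_def subtree_def)
      moreover have "par u \<notin> subtree u"
        using self_notin_anc_par[OF assms] by (simp add: subtree_def)
      moreover from this have "w \<noteq> par u"
        using True by blast
      ultimately show ?thesis
        using eq True par_sub[OF True] deg_eq[OF w] w
        by (cases "w = u") (simp_all add: grain_def max_stable_def)
    next
      case False
      then have "par w \<notin> subtree u" "w \<noteq> u"
        using anc_rec[OF w] anc_refl[OF assms] w by (auto simp: subtree_def)
      moreover have "children w \<inter> subtree u = (if w = par u then {u} else {})"
      proof -
        have "x = u" if x: "x \<in> children w" "x \<in> subtree u" for x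
        proof -
          \<comment> \<open>\<open>w\<close> lies outside the subtree, so a child \<open>x\<close>
            of \<open>w\<close> can lie below \<open>u\<close> only by being \<open>u\<close>
            itself.\<close>
          have "u \<in> insert x (anc w)"
            using x anc_rec[of x] unfolding children_def subtree_def by blast
          then show ?thesis
            using False w by (simp add: subtree_def)
        qed
        moreover have "u \<in> subtree u" "u \<in> children w \<longleftrightarrow> w = par u"
          using assms anc_refl[OF assms] by (auto simp: children_def subtree_def)
        ultimately show ?thesis
          by (simp split: if_split) blast
      qed
      ultimately show ?thesis
        using eq False w by (cases "w = par u") (simp_all add: grain_def)
    qed
  qed
  then have "c' = (\<lambda>w. max_stable w + (if w \<in> nonsink G then grain (par u) w else 0))"
    by blast
  with vs that show thesis by blast
qed

lemma add_grain_topplings: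
  assumes "u \<in> nonsink G"
  shows "\<exists>vs. legal_topplings G (\<lambda>w. max_stable w + grain u w) vs max_stable \<and>
    (\<forall>w\<in>nonsink G. count_list vs w = card (anc u \<inter> anc w))"
  using assms
proof (induction "depth u" arbitrary: u rule: less_induct)
  case less
  note u = less.prems
  obtain vs where vs: "legal_topplings G (\<lambda>w. max_stable w + grain u w) vs
       (\<lambda>w. max_stable w + (if w \<in> nonsink G then grain (par u) w else 0))"
    "distinct vs" "set vs = subtree u"
    using topple_subtree[OF u] .
  obtain ws where ws: "legal_topplings G
      (\<lambda>w. max_stable w + (if w \<in> nonsink G then grain (par u) w else 0)) ws max_stable"
    "\<forall>w\<in>nonsink G. count_list ws w = card (anc (par u) \<inter> anc w)"
  proof (cases "par u \<in> nonsink G")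
    case True
    then have "(\<lambda>w. max_stable w + (if w \<in> nonsink G then grain (par u) w else 0))
        = (\<lambda>w. max_stable w + grain (par u) w)"
      by (auto simp: grain_def)
    with less.hyps[OF depth_par[OF u] True] that show thesis by auto
  next
    \<comment> \<open>The parent is the sink: the grain is gone and no toppling follows, matching
      the empty \<open>anc (sink G)\<close>.\<close>
    case False
    then have "(\<lambda>w. max_stable w + (if w \<in> nonsink G then grain (par u) w else 0)) = max_stable"
      by (auto simp: grain_def)
    with that[of "[]"] False par_cases[OF u] anc_sink show thesis
      by (auto intro: legal_topplings.Nil)
  qed
  have "count_list (vs @ ws) w = card (anc u \<inter> anc w)" if w: "w \<in> nonsink G" for w
  proof -
    \<comment> \<open>The first pass topples \<open>w\<close> once iff \<open>u\<close> is an
      ancestor of \<open>w\<close>; the later passes account for the common ancestors above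
      \<open>u\<close>.\<close>
    have "anc u \<inter> anc w = (if u \<in> anc w then {u} else {}) \<union> (anc (par u) \<inter> anc w)"
      using anc_rec[OF u] by auto
    also have "card \<dots> = (if u \<in> anc w then 1 else 0) + card (anc (par u) \<inter> anc w)"
      using self_notin_anc_par[OF u] finite_anc by auto
    finally show ?thesis
      using vs(2,3) ws(2) w by (simp add: distinct_count_list subtree_def)
  qed
  with legal_topplings_append[OF vs(1) ws(1)] show ?case by blast
qed

section \<open>The only recurrent sandpile\<close>

lemma stable_max_stable: "stable G max_stable"
  by (auto simp: stable_def unstable_def max_stable_def deg_eq)

lemma add_sandpile_topplings:
  assumes "sandpile G b"
  shows "\<exists>vs. legal_topplings G (\<lambda>w. max_stable w + b w) vs max_stable"
  using assms
proof (induction "\<Sum>w\<in>nonsink G. b w" arbitrary: b rule: less_induct)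
  case less
  show ?case
  proof (cases "\<exists>u\<in>nonsink G. b u \<noteq> 0")
    case False
    then have "b w = 0" for w
      using less.prems by (cases "w \<in> nonsink G") (auto simp: sandpile_def)
    then have "(\<lambda>w. max_stable w + b w) = max_stable"
      by simp
    then show ?thesis
      by (metis legal_topplings.Nil)
  next
    case True
    then obtain u where u: "u \<in> nonsink G" "b u \<noteq> 0" by blast
    define b' where "b' = b(u := b u - 1)"
    \<comment> \<open>One grain is split off; its avalanche stays legal with the remaining grains
      \<open>b'\<close> lying on top and restores \<open>max_stable\<close> beneath them.\<close>
    have b: "(\<lambda>w. max_stable w + b w) = (\<lambda>w. (max_stable w + grain u w) + b' w)"
      using u(2) by (auto simp: b'_def grain_def)
    have "(\<Sum>w\<in>nonsink G. b' w) < (\<Sum>w\<in>nonsink G. b w)"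
      by (rule sum_strict_mono_ex1[OF finN]) (use u in \<open>auto simp: b'_def\<close>)
    moreover have "sandpile G b'"
      using less.prems by (auto simp: sandpile_def b'_def)
    ultimately obtain ws where "legal_topplings G (\<lambda>w. max_stable w + b' w) ws max_stable"
      using less.hyps by blast
    moreover obtain vs where "legal_topplings G (\<lambda>w. max_stable w + grain u w) vs max_stable"
      using add_grain_topplings[OF u(1)] by blast
    ultimately have "legal_topplings G (\<lambda>w. max_stable w + b w) (vs @ ws) max_stable"
      unfolding b by (intro legal_topplings_append[OF legal_topplings_add])
    then show ?thesis ..
  qed
qed

text \<open>\<open>max_stable\<close> absorbs every sandpile. So it is reached from any
  \<open>a\<close> with \<open>b = max_stable\<close>, while starting from
  \<open>a = max_stable\<close> nothing else can be reached.\<close>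

lemma recurrents_eq: "recurrents G = {max_stable}"
proof -
  have sp: "sandpile G max_stable"
    by (simp add: sandpile_def max_stable_def)
  have add: "stable_add G max_stable b = max_stable" if "sandpile G b" for b
    using add_sandpile_topplings[OF that] stabilization_eqI[OF graph _ stable_max_stable]
    unfolding stable_add_def by blast
  have add': "stable_add G b max_stable = max_stable" if "sandpile G b" for b
    using add[OF that] by (simp add: stable_add_def add.commute)
  show ?thesis
    using sp stable_max_stable add add' unfolding recurrents_def by fastforce
qed

lemma toppling_vector_eq:
  assumes "u \<in> nonsink G" "w \<in> nonsink G"
  shows "toppling_vector G (\<lambda>w. max_stable w + grain u w) w = card (anc u \<inter> anc w)"
  using add_grain_topplings[OF assms(1)] toppling_vector_eqI[OF graph _ stable_max_stable] assms(2)
  by metis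

lemma card_anc_Int_le: "card (anc u \<inter> anc w) \<le> card (anc w)"
  using finite_anc by (intro card_mono) auto

text \<open>This reads the ancestor relation off the matrix: an entry attains the bound of column
  \<open>w\<close> exactly in the rows of descendants of \<open>w\<close>.\<close>

lemma card_anc_Int_eq_iff:
  assumes "w \<in> nonsink G"
  shows "card (anc u \<inter> anc w) = card (anc w) \<longleftrightarrow> w \<in> anc u"
proof
  assume "card (anc u \<inter> anc w) = card (anc w)"
  then have "anc u \<inter> anc w = anc w"
    using finite_anc by (intro card_subset_eq) auto
  then show "w \<in> anc u"
    using anc_refl[OF assms] by blast
next
  assume "w \<in> anc u"
  then have "anc u \<inter> anc w = anc w"
    using anc_trans by blast
  then show "card (anc u \<inter> anc w) = card (anc w)" by simp
qed

end

section \<open>Exponents of the avalanche polynomial\<close>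

lemma var_power: "var i ^ k = Poly_Mapping.single (Poly_Mapping.single i k) 1"
proof (induction k)
  case 0
  then show ?case by simp
next
  case (Suc k)
  then show ?case
    by (simp add: var_def mult_single flip: single_add)
qed

lemma prod_var_power:
  "finite I \<Longrightarrow> (\<Prod>i\<in>I. var i ^ f i) = Poly_Mapping.single (\<Sum>i\<in>I. Poly_Mapping.single i (f i)) 1"
  by (induction rule: finite_induct) (simp_all add: var_power mult_single)

text \<open>Each coefficient counts coinciding exponents, so nothing cancels.\<close>

lemma keys_sum_single:
  assumes "finite A"
  shows "Poly_Mapping.keys (\<Sum>u\<in>A. Poly_Mapping.single (e u) (1::int)) = e ` A"
proof -
  have "Poly_Mapping.lookup (\<Sum>u\<in>A. Poly_Mapping.single (e u) (1::int)) m = int (card {u \<in> A. m = e u})" for m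
    using assms by (simp add: lookup_sum sum.If_cases Int_def)
  then show ?thesis
    using assms by (auto simp: in_keys_iff card_eq_0_iff)
qed

lemma (in rooted_sandpile_tree) keys_avalanche_poly:
  assumes "bij_betw v {1..n} (nonsink G)"
  shows "Poly_Mapping.keys (avalanche_poly n v G) =
    (\<lambda>u. \<Sum>i=1..n. Poly_Mapping.single i (card (anc u \<inter> anc (v i)))) ` nonsink G"
proof -
  have "avalanche_monomial n v G max_stable u =
      Poly_Mapping.single (\<Sum>i=1..n. Poly_Mapping.single i (card (anc u \<inter> anc (v i)))) 1"
    if "u \<in> nonsink G" for u
  proof -
    have "v i \<in> nonsink G" if "i \<in> {1..n}" for i
      using that assms by (auto dest: bij_betwE)
    then have "(\<Sum>i=1..n. Poly_Mapping.single i
          (toppling_vector G (\<lambda>w. max_stable w + grain u w) (v i))) =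
        (\<Sum>i=1..n. Poly_Mapping.single i (card (anc u \<inter> anc (v i))))"
      using \<open>u \<in> nonsink G\<close> by (intro sum.cong) (auto simp: toppling_vector_eq)
    then show ?thesis
      by (simp add: avalanche_monomial_def prod_var_power)
  qed
  then have "avalanche_poly n v G = (\<Sum>u\<in>nonsink G.
      Poly_Mapping.single (\<Sum>i=1..n. Poly_Mapping.single i (card (anc u \<inter> anc (v i)))) 1)"
    by (simp add: avalanche_poly_def recurrents_eq)
  then show ?thesis
    by (simp only: keys_sum_single[OF finN])
qed

section \<open>Rooting a tree at its sink\<close>

lemma rtrancl_distinct_path:
  assumes "(a, b) \<in> r\<^sup>*"
  shows "\<exists>p. p \<noteq> [] \<and> hd p = a \<and> last p = b \<and> distinct p \<and>
    (\<forall>i. Suc i < length p \<longrightarrow> (p ! i, p ! Suc i) \<in> r)"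
  using assms
proof induction
  case base
  then show ?case by (intro exI[of _ "[a]"]) simp
next
  case (step x y)
  then obtain p where p: "p \<noteq> []" "hd p = a" "last p = x" "distinct p"
    "\<And>i. Suc i < length p \<Longrightarrow> (p ! i, p ! Suc i) \<in> r"
    by blast
  show ?case
  proof (cases "y \<in> set p")
    case True
    then obtain j where j: "j < length p" "p ! j = y"
      by (auto simp: in_set_conv_nth)
    \<comment> \<open>If \<open>y\<close> was visited before, the path is cut back to that
      visit.\<close>
    then have "last (take (Suc j) p) = y"
      by (simp add: take_Suc_conv_app_nth)
    then show ?thesis
      using p by (intro exI[of _ "take (Suc j) p"]) auto
  next
    case False
    have "((p @ [y]) ! i, (p @ [y]) ! Suc i) \<in> r" if "Suc i < length (p @ [y])" for i
    proof (cases "Suc i = length p")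
      case True
      then have "p ! i = x"
        using p(1,3) by (metis diff_Suc_1 last_conv_nth)
      with True step.hyps(2) show ?thesis
        by (simp add: nth_append)
    next
      case False
      then show ?thesis
        using that p(5) by (simp add: nth_append)
    qed
    then show ?thesis
      using p False by (intro exI[of _ "p @ [y]"]) auto
  qed
qed

text \<open>A simple path in \<open>F\<close> is closed by the additional edge. Multisets cover the
  case that \<open>{a, b}\<close> is already in \<open>F\<close>: the second copy then yields a
  cycle of length 2.\<close>

lemma extra_edge_cycle:
  assumes "finite F" and F: "mset_set F + {#{a, b}#} \<subseteq># edges G"
    and ab: "(a, b) \<in> {(x, y). {x, y} \<in> F}\<^sup>*" "a \<noteq> b"
  shows "\<exists>p. is_cycle G p"
proof -
  obtain p where p: "p \<noteq> []" "hd p = a" "last p = b" "distinct p"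
    "\<And>i. Suc i < length p \<Longrightarrow> {p ! i, p ! Suc i} \<in> F"
    using rtrancl_distinct_path[OF ab(1)] by blast
  obtain m where m: "length p = Suc m"
    using p(1) by (cases p) auto
  have "p ! 0 = a" "p ! m = b"
    using p(1-3) m by (simp_all add: hd_conv_nth last_conv_nth)
  with ab(2) have "m \<noteq> 0" by metis
  let ?e = "\<lambda>i. {p ! i, p ! Suc i}"
  have inj: "inj_on ?e {0..<m}"
    using p(4) m by (auto simp: inj_on_def doubleton_eq_iff nth_eq_iff_index_eq)
  \<comment> \<open>The last index \<open>m\<close> wraps around to 0 and contributes the closing
    edge.\<close>
  have "map (\<lambda>i. {p ! i, p ! (Suc i mod length p)}) [0..<length p] = map ?e [0..<m] @ [{a, b}]"
    using m \<open>p ! 0 = a\<close> \<open>p ! m = b\<close> by auto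
  moreover have "mset (map ?e [0..<m]) = mset_set (?e ` {0..<m})"
    using image_mset_mset_set[OF inj] by simp
  moreover have "mset_set (?e ` {0..<m}) \<subseteq># mset_set F"
    using p(5) m assms(1) by (intro subset_imp_msubset_mset_set) auto
  ultimately have "mset (map (\<lambda>i. {p ! i, p ! (Suc i mod length p)}) [0..<length p])
      \<subseteq># mset_set F + {#{a, b}#}"
    by simp
  then have "mset (map (\<lambda>i. {p ! i, p ! (Suc i mod length p)}) [0..<length p]) \<subseteq># edges G"
    using F by (rule subset_mset.order_trans)
  then have "is_cycle G p"
    using m \<open>m \<noteq> 0\<close> p(4) by (simp add: is_cycle_def)
  then show ?thesis ..
qed

text \<open>With the distance to the sink as \<open>depth\<close>, each non-sink vertex picks a
  neighbour closer to the sink as parent. The parent edges already connect the graph, so any further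
  edge would create a cycle.\<close>

lemma tree_imp_rooted:
  assumes "tree G"
  obtains par depth where "rooted_sandpile_tree G par depth"
proof -
  have G: "sandpile_graph G" and acyclic: "\<not> (\<exists>p. is_cycle G p)"
    using assms by (auto simp: tree_def)
  define R where "R = {(a, b). {a, b} \<in># edges G}"
  define depth where "depth v = (LEAST k. (v, sink G) \<in> R ^^ k)" for v
  have edge: "e \<subseteq> verts G" "card e = 2" if "e \<in># edges G" for e
    using that G by (auto simp: sandpile_graph_def)
  have "\<exists>w. w \<in> verts G \<and> {v, w} \<in># edges G \<and> depth w < depth v" if v: "v \<in> nonsink G" for v
  proof -
    have "(v, sink G) \<in> R\<^sup>*"
      using G v by (auto simp: sandpile_graph_def connected_graph_def nonsink_def R_def)
    then have dv: "(v, sink G) \<in> R ^^ depth v"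
      unfolding depth_def by (metis LeastI rtrancl_power)
    have "depth v \<noteq> 0"
      using dv v by (cases "depth v") (auto simp: nonsink_def)
    then obtain k where k: "depth v = Suc k"
      using not0_implies_Suc by blast
    then obtain w where w: "(v, w) \<in> R" "(w, sink G) \<in> R ^^ k"
      using dv relpow_Suc_D2[of v "sink G" k R] by auto
    have "depth w \<le> k"
      unfolding depth_def using w(2) by (rule Least_le)
    then show ?thesis
      using w(1) k edge(1) by (auto simp: R_def intro!: exI[of _ w])
  qed
  then obtain par where par: "\<And>v. v \<in> nonsink G \<Longrightarrow>
      par v \<in> verts G \<and> {v, par v} \<in># edges G \<and> depth (par v) < depth v"
    by metis
  define F where "F = (\<lambda>v. {v, par v}) ` nonsink G"
  have finF: "finite F"
    using finite_nonsink[OF G] by (simp add: F_def)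
  have inj: "inj_on (\<lambda>v. {v, par v}) (nonsink G)"
  proof (rule inj_onI)
    fix x y assume "x \<in> nonsink G" "y \<in> nonsink G" "{x, par x} = {y, par y}"
    then show "x = y"
      using par[of x] par[of y] by (auto simp: doubleton_eq_iff)
  qed
  have sub: "mset_set F \<subseteq># edges G"
    using par finF by (auto simp: subseteq_mset_def F_def count_mset_set' Suc_le_eq)
  have "edges G = mset_set F"
  proof (rule ccontr)
    assume "edges G \<noteq> mset_set F"
    then have "edges G - mset_set F \<noteq> {#}"
      using sub by (metis add.right_neutral subset_mset.add_diff_inverse)
    \<comment> \<open>The multiset difference allows \<open>e\<close> to be a parallel copy of a
      parent edge.\<close>
    then obtain e where e: "e \<in># edges G - mset_set F" by blast
    then have sub': "mset_set F + {#e#} \<subseteq># edges G"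
      using sub by (metis mset_subset_eq_single subset_mset.add_diff_inverse subset_mset.add_left_mono)
    have "e \<in># edges G"
      using e by (rule in_diffD)
    then obtain a b where ab: "e = {a, b}" "a \<noteq> b" "a \<in> verts G" "b \<in> verts G"
      using edge[of e] by (auto simp: card_2_iff)
    let ?Q = "{(x, y). {x, y} \<in> F}"
    have to_sink: "(x, sink G) \<in> ?Q\<^sup>*" if "x \<in> verts G" for x
      using that
    proof (induction "depth x" arbitrary: x rule: less_induct)
      case less
      show ?case
      proof (cases "x = sink G")
        case False
        with less.prems have x: "x \<in> nonsink G" by (simp add: nonsink_def)
        then have "(x, par x) \<in> ?Q" by (auto simp: F_def)
        moreover have "(par x, sink G) \<in> ?Q\<^sup>*"
          using less.hyps par[OF x] by blast
        ultimately show ?thesis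
          by (rule converse_rtrancl_into_rtrancl)
      qed simp
    qed
    have "sym ?Q"
      by (auto simp: sym_def insert_commute)
    then have "(a, b) \<in> ?Q\<^sup>*"
      using to_sink[OF ab(3)] to_sink[OF ab(4)] by (meson rtrancl_trans sym_rtrancl symD)
    then show False
      using extra_edge_cycle[OF finF _ _ ab(2), of G] sub' ab(1) acyclic by blast
  qed
  then have "edges G = image_mset (\<lambda>v. {v, par v}) (mset_set (nonsink G))"
    by (simp add: F_def image_mset_mset_set[OF inj])
  with G par have "rooted_sandpile_tree G par depth"
    by unfold_locales auto
  with that show thesis .
qed

section \<open>Reconstruction of the tree\<close>

text \<open>The row of \<open>u\<close> in \<open>G'\<close> is the row of some \<open>x\<close> in
  \<open>G\<close>, possibly another vertex. It is maximal in column \<open>u\<close>, so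
  \<open>x\<close> descends from \<open>u\<close> in \<open>G\<close>; hence it is maximal in the
  column of every ancestor of \<open>u\<close> in \<open>G\<close>.\<close>

lemma anc_subset_if_rows:
  assumes A: "rooted_sandpile_tree G par depth" and B: "rooted_sandpile_tree G' par' depth'"
    and N: "nonsink G' = nonsink G"
    and rows: "\<And>u. u \<in> nonsink G \<Longrightarrow> \<exists>x\<in>nonsink G. \<forall>w\<in>nonsink G.
      card (rooted_sandpile_tree.anc G' par' u \<inter> rooted_sandpile_tree.anc G' par' w) =
      card (rooted_sandpile_tree.anc G par x \<inter> rooted_sandpile_tree.anc G par w)"
    and depth: "\<And>w. w \<in> nonsink G \<Longrightarrow>
      card (rooted_sandpile_tree.anc G' par' w) = card (rooted_sandpile_tree.anc G par w)"
    and u: "u \<in> nonsink G"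
  shows "rooted_sandpile_tree.anc G par u \<subseteq> rooted_sandpile_tree.anc G' par' u"
proof
  interpret A: rooted_sandpile_tree G par depth by fact
  interpret B: rooted_sandpile_tree G' par' depth' by fact
  fix w assume w: "w \<in> A.anc u"
  then have wN: "w \<in> nonsink G" using A.anc_subset by blast
  obtain x where x: "\<And>w. w \<in> nonsink G \<Longrightarrow>
      card (B.anc u \<inter> B.anc w) = card (A.anc x \<inter> A.anc w)"
    using rows[OF u] by blast
  have "card (A.anc x \<inter> A.anc u) = card (A.anc u)"
    using x[OF u] depth[OF u] by simp
  then have "u \<in> A.anc x"
    using A.card_anc_Int_eq_iff[OF u] by simp
  then have "w \<in> A.anc x"
    using w A.anc_trans by blast
  then have "card (B.anc u \<inter> B.anc w) = card (B.anc w)"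
    using x[OF wN] depth[OF wN] A.card_anc_Int_eq_iff[OF wN] by simp
  then show "w \<in> B.anc u"
    using B.card_anc_Int_eq_iff wN N by simp
qed

theorem theorem20:
  fixes n :: nat and v :: "nat \<Rightarrow> 'v" and s :: 'v and T T' :: "'v sgraph"
  assumes "tree T" and "sink T = s" and "bij_betw v {1..n} (nonsink T)"
    and "tree T'" and "sink T' = s" and "bij_betw v {1..n} (nonsink T')"
    and "avalanche_poly n v T = avalanche_poly n v T'"
  shows "T = T'"
proof -
  obtain par depth where A: "rooted_sandpile_tree T par depth"
    using tree_imp_rooted[OF assms(1)] .
  obtain par' depth' where B: "rooted_sandpile_tree T' par' depth'"
    using tree_imp_rooted[OF assms(4)] .
  interpret A: rooted_sandpile_tree T par depth by fact
  interpret B: rooted_sandpile_tree T' par' depth' by fact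
  have N: "nonsink T' = nonsink T"
    using assms(3,6) by (simp add: bij_betw_def)
  have verts: "verts T' = verts T"
    using N A.graph B.graph assms(2,5) by (auto simp: sandpile_graph_def nonsink_def)
  let ?e = "\<lambda>f. \<Sum>i=1..n. Poly_Mapping.single i (f (v i)) :: nat \<Rightarrow>\<^sub>0 nat"
  have keys: "(\<lambda>u. ?e (\<lambda>w. card (A.anc u \<inter> A.anc w))) ` nonsink T
      = (\<lambda>u. ?e (\<lambda>w. card (B.anc u \<inter> B.anc w))) ` nonsink T"
    using A.keys_avalanche_poly[OF assms(3)] B.keys_avalanche_poly[OF assms(6)] assms(7) N by simp
  \<comment> \<open>The labelling hits every non-sink vertex, so an exponent vector determines the
    whole row.\<close>
  have e_inj: "f w = g w" if eq: "?e f = ?e g" and "w \<in> nonsink T" for f g w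
  proof -
    obtain i where i: "i \<in> {1..n}" "w = v i"
      using \<open>w \<in> nonsink T\<close> assms(3) by (metis bij_betw_imp_surj_on imageE)
    have "Poly_Mapping.lookup (?e h) i = h (v i)" for h
      using i(1) by (simp add: lookup_sum lookup_single when_def)
    then show ?thesis
      using eq i(2) by metis
  qed
  have rows: "\<exists>x\<in>nonsink T. \<forall>w\<in>nonsink T. f u w = g x w"
    if eq: "(\<lambda>u. ?e (f u)) ` nonsink T = (\<lambda>u. ?e (g u)) ` nonsink T" and u: "u \<in> nonsink T"
    for f g u
  proof -
    have "?e (f u) \<in> (\<lambda>u. ?e (g u)) ` nonsink T"
      unfolding eq[symmetric] using u by (rule imageI)
    then obtain x where "x \<in> nonsink T" "?e (f u) = ?e (g x)"
      by (rule imageE)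
    with e_inj show ?thesis by metis
  qed
  note rows1 = rows[OF keys] and rows2 = rows[OF keys[symmetric]]
  \<comment> \<open>The maximum of column \<open>w\<close> is its diagonal entry
    \<open>card (anc w)\<close>; equal sets of rows have equal column maxima.\<close>
  have depth: "card (A.anc w) = card (B.anc w)" if w: "w \<in> nonsink T" for w
  proof (rule antisym)
    show "card (A.anc w) \<le> card (B.anc w)"
      using rows1[OF w] w B.card_anc_Int_le by (metis Int_absorb)
    show "card (B.anc w) \<le> card (A.anc w)"
      using rows2[OF w] w A.card_anc_Int_le by (metis Int_absorb)
  qed
  have anc: "A.anc u = B.anc u" if "u \<in> nonsink T" for u
    using anc_subset_if_rows[OF A B N rows2 _ that] anc_subset_if_rows[OF B A N[symmetric] _ _]
      rows1 depth that N by (metis subset_antisym)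
  \<comment> \<open>The sink is included because a parent may be the sink.\<close>
  have anc_verts: "A.anc x = B.anc x" if "x \<in> verts T" for x
    using that anc A.anc_sink B.anc_sink assms(2,5) by (cases "x = s") (auto simp: nonsink_def)
  have par: "par u = par' u" if u: "u \<in> nonsink T" for u
  proof -
    \<comment> \<open>Both sides are the common ancestor set of \<open>u\<close> with
      \<open>u\<close> removed; injectivity of \<open>anc\<close> then identifies the
      parents.\<close>
    have "B.anc (par u) = B.anc (par' u)"
      using A.anc_par[OF u] B.anc_par anc[OF u] anc_verts A.par_verts[OF u] u N by metis
    then show ?thesis
      using B.anc_inj A.par_verts[OF u] B.par_verts u N verts by (metis inj_onD)
  qed
  have "edges T = edges T'"
    unfolding A.edges_eq B.edges_eq N
    by (intro image_mset_cong) (simp add: par A.finN)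
  with verts assms(2,5) show "T = T'"
    by simp
qed

end
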